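(* Let $G \subset \mathbb{R}^n$ be an open set, and let $\mu$ be a probability measure on $(G, \mathcal{B}(G))$ which satisfies a logarithmic Sobolev inequality with constant $\sigma^2 > 0$. Let $f \colon G \to \mathbb{R}$ be a $\mathcal{C}^2$-smooth function such that $f \in L^1(\mu)$ and $\partial_i f \in L^1(\mu)$ for all $i=1,\ldots,n$. Assume that $\int_G f\, d\mu = 0$ and $\sum_{i=1}^n \big(\int_G \partial_i f\, d\mu\big)^2 \le \sigma^2 b_0^2$ for some $b_0 \ge 0$. Moreover, assume that $$\lVert f''(x) \rVert_{\mathrm{Op}} \le 1 \ \text{ for all } x \in G \qquad\text{and}\qquad \int_G \lVert f''(x) \rVert_{\mathrm{HS}}^2\, d\mu \le b^2$$ for some $b \ge 0$. Then $$\int_G \exp\left(\frac{1}{\sigma^2(4+4b^2+5b_0)}|f|\right) d\mu \le 2.$$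
   Context: $\mathcal B(G)$ is the Borel $\sigma$-algebra. $\mu$ satisfies a logarithmic Sobolev inequality with constant $\sigma^2>0$ if for all locally Lipschitz functions $u\colon G\to\mathbb{R}$, $$\mathrm{Ent}_\mu(u^2)\le 2\sigma^2\int_G|\nabla u|^2d\mu,$$ where $\mathrm{Ent}_\mu(u^2)=\int u^2\log u^2\,d\mu-\int u^2d\mu\,\log\int u^2d\mu$ and $|\nabla u|$ is the Euclidean norm of the gradient. $\partial_if$ is the $i$-th partial derivative, $f''$ the Hessian of $f$, and $\lVert\cdot\rVert_{\mathrm{Op}}$, $\lVert\cdot\rVert_{\mathrm{HS}}$ denote the operator norm and the Hilbert–Schmidt norm. *)

theory Defs
  imports "HOL-Probability.Probability"
begin

definition partial_deriv :: "'n::finite \<Rightarrow> (real^'n \<Rightarrow> real) \<Rightarrow> real^'n \<Rightarrow> real" where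
  "partial_deriv i f x = deriv (\<lambda>t. f (x + t *\<^sub>R axis i 1)) 0"

definition gradient :: "(real^'n \<Rightarrow> real) \<Rightarrow> real^'n \<Rightarrow> real^'n" where
  "gradient f x = (\<chi> i. partial_deriv i f x)"

definition hessian :: "(real^'n \<Rightarrow> real) \<Rightarrow> real^'n \<Rightarrow> real^'n^'n" where
  "hessian f x = (\<chi> i j. partial_deriv i (partial_deriv j f) x)"

definition op_norm :: "real^'n^'n \<Rightarrow> real" where
  "op_norm A = onorm (\<lambda>v. A *v v)"

definition hs_norm :: "real^'n^'n \<Rightarrow> real" where
  "hs_norm A = sqrt (\<Sum>i\<in>UNIV. \<Sum>j\<in>UNIV. (A $ i $ j)\<^sup>2)"

definition C1_on :: "(real^'n) set \<Rightarrow> (real^'n \<Rightarrow> real) \<Rightarrow> bool" where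
  "C1_on G f \<longleftrightarrow> f differentiable_on G \<and> (\<forall>i. continuous_on G (partial_deriv i f))"

definition C2_on :: "(real^'n) set \<Rightarrow> (real^'n \<Rightarrow> real) \<Rightarrow> bool" where
  "C2_on G f \<longleftrightarrow> C1_on G f \<and> (\<forall>i. C1_on G (partial_deriv i f))"

definition locally_lipschitz_on :: "(real^'n) set \<Rightarrow> (real^'n \<Rightarrow> real) \<Rightarrow> bool" where
  "locally_lipschitz_on G u \<longleftrightarrow> (\<forall>x\<in>G. \<exists>e>0. \<exists>L. L-lipschitz_on (ball x e \<inter> G) u)"

text \<open>
  The Euclidean norm of the gradient of a locally Lipschitz function. Such a function is
  differentiable Lebesgue-almost everywhere, but a measure that is not absolutely continuous
  may charge points of non-differentiability; there the usual generalized modulus of the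
  gradient, \<open>limsup \<bar>u y - u x\<bar> / \<bar>y - x\<bar>\<close> as \<open>y\<close> tends to \<open>x\<close>, is used. At points of
  differentiability the two quantities coincide.
\<close>
definition grad_norm :: "(real^'n \<Rightarrow> real) \<Rightarrow> real^'n \<Rightarrow> ennreal" where
  "grad_norm u x =
    (if u differentiable (at x) then ennreal (norm (gradient u x))
     else Limsup (at x) (\<lambda>y. ennreal (\<bar>u y - u x\<bar> / dist y x)))"

text \<open>
  The entropy of a nonnegative function \<open>g\<close>, with \<open>0 log 0 = 0\<close>. Since \<open>t log t\<close> is bounded
  below, for a probability measure the integral of \<open>g log g\<close> always exists in
  \<open>(-\<infinity>, \<infinity>]\<close>; the entropy is infinite when that integral is.
\<close>
definition Ent :: "'a measure \<Rightarrow> ('a \<Rightarrow> real) \<Rightarrow> ereal" where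
  "Ent M g =
    (if integrable M g \<and> integrable M (\<lambda>x. g x * ln (g x))
     then ereal ((\<integral>x. g x * ln (g x) \<partial>M) - (\<integral>x. g x \<partial>M) * ln (\<integral>x. g x \<partial>M))
     else \<infinity>)"

text \<open>The right-hand side is an extended integral: it may be infinite.\<close>
definition log_sobolev :: "(real^'n) set \<Rightarrow> (real^'n) measure \<Rightarrow> real \<Rightarrow> bool" where
  "log_sobolev G M c \<longleftrightarrow>
    (\<forall>u. locally_lipschitz_on G u \<longrightarrow>
      Ent M (\<lambda>x. (u x)\<^sup>2) \<le> ereal (2 * c) * enn2ereal (\<integral>\<^sup>+ x. (grad_norm u x)\<^sup>2 \<partial>M))"

end

theory Submission
  imports Defs
begin

text \<open>
  Write \<open>c = \<sigma>\<^sup>2\<close> and \<open>F = \<bar>\<nabla>f\<bar>\<^sup>2\<close>. Three consequences of the logarithmic Sobolev inequality are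
  chained, each one controlling the next.

  First (\<open>poincare\<close>), the partial derivatives of \<open>f\<close> have variance at most \<open>2 c\<close> times the
  mean of their squared gradients. Summing over the coordinates turns the squared gradients into
  the Hilbert-Schmidt norm of the Hessian, whence \<open>\<integral> F \<le> c (b\<^sub>0\<^sup>2 + 2 b\<^sup>2)\<close>. The sharp Poincare
  constant is \<open>c\<close>, but the cheaper \<open>2 c\<close> leaves ample room below.

  Secondly (\<open>exp_moment_self_bounding\<close>), since \<open>\<nabla>F = 2 f'' \<nabla>f\<close> and the Hessian is a contraction,
  \<open>F\<close> satisfies \<open>\<bar>\<nabla>F\<bar>\<^sup>2 \<le> 4 F\<close>. For such functions the logarithmic Sobolev inequality applied to
  \<open>exp (t F / 2)\<close> is a differential inequality for \<open>t \<mapsto> ln (\<integral> exp (t F)) / t\<close>. It gives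
  \<open>\<integral> exp (T F) \<le> exp (T / (1 - 2 c T) * \<integral> F)\<close> as long as \<open>2 c T < 1\<close>.

  Thirdly (\<open>exp_moment_gradient\<close>), a centred function obeys
  \<open>\<integral> exp (l f) \<le> \<integral> exp (c l\<^sup>2 \<bar>\<nabla>f\<bar>\<^sup>2)\<close>. This combines the logarithmic Sobolev inequality for
  \<open>exp (t f / 2)\<close> with the duality between entropy and exponential integrals, which bounds the
  integral of \<open>\<bar>\<nabla>f\<bar>\<^sup>2\<close> against the tilted measure.

  In the last two steps integrability is unknown beforehand, so the inequalities are first proved
  for bounded functions, and \<open>F\<close> and \<open>f\<close> are approximated by \<open>F / (1 + F / N)\<close> and
  \<open>N arctan (f / N)\<close>. Both truncations are smooth and preserve the hypotheses on the gradient.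

  With \<open>K = 4 + 4 b\<^sup>2 + 5 b\<^sub>0\<close> and \<open>l = 1 / (c K)\<close>, the steps are used with the doubled exponent
  \<open>2 l\<close> for \<open>f\<close> and \<open>- f\<close>, hence with \<open>T = c (2 l)\<^sup>2\<close>. They show that \<open>exp (2 l f)\<close> and
  \<open>exp (- 2 l f)\<close> have integral at most \<open>2\<close>. Doubling is what makes the bound for \<open>\<bar>f\<bar>\<close> come out
  as \<open>2\<close>: from \<open>z \<le> 1 + z\<^sup>2 / 4\<close> with \<open>z = exp (l \<bar>f\<bar>)\<close> one gets
  \<open>\<integral> exp (l \<bar>f\<bar>) \<le> 1 + (2 + 2) / 4\<close>.
\<close>

section \<open>Gradients and locally Lipschitz functions\<close>

lemma gradient_eqI:
  fixes u :: "real^'n \<Rightarrow> real"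
  assumes "(u has_derivative (\<lambda>v. w \<bullet> v)) (at x)"
  shows "gradient u x = w"
proof -
  have "partial_deriv i u x = w $ i" for i
  proof -
    have line: "((\<lambda>t::real. x + t *\<^sub>R axis i 1) has_derivative (\<lambda>t. t *\<^sub>R axis i 1)) (at 0)"
      by (auto intro!: derivative_eq_intros)
    have "((\<lambda>t. u (x + t *\<^sub>R axis i 1)) has_derivative (\<lambda>t. w \<bullet> (t *\<^sub>R axis i 1))) (at 0)"
      using diff_chain_at[OF line, of u "\<lambda>v. w \<bullet> v"] assms by (simp add: o_def)
    then have "((\<lambda>t. u (x + t *\<^sub>R axis i 1)) has_field_derivative w $ i) (at 0)"
      by (simp add: has_field_derivative_def inner_axis mult.commute[of "w $ i"] mult_commute_abs)
    then show ?thesis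
      unfolding partial_deriv_def by (rule DERIV_imp_deriv)
  qed
  then show ?thesis
    by (simp add: gradient_def vec_eq_iff)
qed

lemma has_derivative_gradient:
  fixes u :: "real^'n \<Rightarrow> real"
  assumes "u differentiable (at x)"
  shows "(u has_derivative (\<lambda>v. gradient u x \<bullet> v)) (at x)"
proof -
  obtain D where D: "(u has_derivative D) (at x)"
    using assms by (auto simp: differentiable_def)
  have "D v = adjoint D 1 \<bullet> v" for v
    using adjoint_works[of D v 1] has_derivative_linear[OF D] by (simp add: inner_commute)
  with D have "(u has_derivative (\<lambda>v. adjoint D 1 \<bullet> v)) (at x)"
    by (metis (no_types, lifting) ext)
  then show ?thesis
    by (simp add: gradient_eqI)
qed

text \<open>
  The continuous gradient is bounded on a compact ball inside \<open>G\<close>, and the mean value inequality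
  applies there because balls are convex.
\<close>

lemma locally_lipschitz_onI:
  fixes u :: "real^'n \<Rightarrow> real"
  assumes G: "open G"
    and u: "\<And>x. x \<in> G \<Longrightarrow> (u has_derivative (\<lambda>v. w x \<bullet> v)) (at x)"
    and w: "continuous_on G w"
  shows "locally_lipschitz_on G u"
  unfolding locally_lipschitz_on_def
proof
  fix x assume "x \<in> G"
  then obtain e where e: "e > 0" "cball x e \<subseteq> G"
    using G open_contains_cball by blast
  have "bounded (w ` cball x e)"
    using continuous_on_subset[OF w e(2)]
    by (simp add: compact_imp_bounded compact_continuous_image)
  then obtain L where L: "L > 0" "\<And>y. y \<in> cball x e \<Longrightarrow> norm (w y) \<le> L"
    unfolding bounded_pos by (metis imageI)
  have "L-lipschitz_on (ball x e) u"
  proof (rule lipschitz_onI)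
    fix y z assume yz: "y \<in> ball x e" "z \<in> ball x e"
    have "norm (u y - u z) \<le> L * norm (y - z)"
    proof (rule differentiable_bound[where S="ball x e" and f'="\<lambda>x v. w x \<bullet> v"])
      fix p assume p: "p \<in> ball x e"
      then show "(u has_derivative (\<lambda>v. w p \<bullet> v)) (at p within ball x e)"
        using e(2) u has_derivative_at_withinI by (meson ball_subset_cball subsetD)
      show "onorm (\<lambda>v. w p \<bullet> v) \<le> L"
      proof (rule onorm_le)
        fix v
        have "norm (w p \<bullet> v) \<le> norm (w p) * norm v"
          by (simp add: Cauchy_Schwarz_ineq2)
        also have "\<dots> \<le> L * norm v"
          using L(2)[of p] p by (intro mult_right_mono) auto
        finally show "norm (w p \<bullet> v) \<le> L * norm v" .
      qed
    qed (use yz in simp_all)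
    then show "dist (u y) (u z) \<le> L * dist y z"
      by (simp add: dist_norm)
  qed (use L(1) in simp)
  then have "L-lipschitz_on (ball x e \<inter> G) u"
    by (rule lipschitz_on_subset) auto
  then show "\<exists>e>0. \<exists>L. L-lipschitz_on (ball x e \<inter> G) u"
    using e(1) by metis
qed

text \<open>
  Carrying the gradient as a second argument lets chain rules produce it explicitly; on \<open>G\<close> it
  agrees with \<open>gradient u\<close> by \<open>gradient_eqI\<close>.
\<close>

definition has_C1_gradient :: "(real^'n) set \<Rightarrow> (real^'n \<Rightarrow> real) \<Rightarrow> (real^'n \<Rightarrow> real^'n) \<Rightarrow> bool" where
  "has_C1_gradient G u w \<longleftrightarrow>
    (\<forall>x\<in>G. (u has_derivative (\<lambda>v. w x \<bullet> v)) (at x)) \<and> continuous_on G w"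

lemma has_C1_gradient_imp_continuous_on:
  "has_C1_gradient G u w \<Longrightarrow> continuous_on G u"
  unfolding has_C1_gradient_def
  by (meson continuous_at_imp_continuous_on has_derivative_continuous)

lemma has_C1_gradient_compose:
  assumes u: "has_C1_gradient G u w"
    and \<phi>: "\<And>x. x \<in> G \<Longrightarrow> (\<phi> has_real_derivative \<phi>' (u x)) (at (u x))"
    and cont: "continuous_on (u ` G) \<phi>'"
  shows "has_C1_gradient G (\<lambda>x. \<phi> (u x)) (\<lambda>x. \<phi>' (u x) *\<^sub>R w x)"
  unfolding has_C1_gradient_def
proof (intro conjI ballI)
  fix x assume x: "x \<in> G"
  have "((\<lambda>x. \<phi> (u x)) has_derivative (\<lambda>v. \<phi>' (u x) * (w x \<bullet> v))) (at x)"
    using diff_chain_at[of u "\<lambda>v. w x \<bullet> v" x \<phi> "(*) (\<phi>' (u x))"] u \<phi>[OF x] x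
    by (simp add: has_C1_gradient_def has_field_derivative_def o_def)
  then show "((\<lambda>x. \<phi> (u x)) has_derivative (\<lambda>v. (\<phi>' (u x) *\<^sub>R w x) \<bullet> v)) (at x)"
    by simp
next
  show "continuous_on G (\<lambda>x. \<phi>' (u x) *\<^sub>R w x)"
    using u continuous_on_compose2[OF cont has_C1_gradient_imp_continuous_on[OF u]]
    by (auto simp: has_C1_gradient_def intro!: continuous_on_scaleR)
qed

lemma C1_on_imp_has_C1_gradient:
  assumes "open G" "C1_on G u"
  shows "has_C1_gradient G u (gradient u)"
  unfolding has_C1_gradient_def
proof (intro conjI ballI)
  show "(u has_derivative (\<lambda>v. gradient u x \<bullet> v)) (at x)" if "x \<in> G" for x
    using assms that by (intro has_derivative_gradient)
      (simp add: C1_on_def differentiable_on_eq_differentiable_at)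
  show "continuous_on G (gradient u)"
    using assms by (auto simp: gradient_def[abs_def] C1_on_def intro!: continuous_on_vec_lambda)
qed

section \<open>Exponential moments of a bounded function\<close>

context prob_space
begin

abbreviation mgf :: "('a \<Rightarrow> real) \<Rightarrow> real \<Rightarrow> real" where
  "mgf g t \<equiv> expectation (\<lambda>x. exp (t * g x))"

lemma integrable_bounded_continuous:
  fixes g :: "'a \<Rightarrow> real"
  assumes g: "g \<in> borel_measurable M" "\<And>x. x \<in> space M \<Longrightarrow> \<bar>g x\<bar> \<le> B"
    and h: "continuous_on UNIV (h :: real \<Rightarrow> real)"
  shows "integrable M (\<lambda>x. h (g x))"
proof -
  have "bounded (h ` {-B..B})"
    by (intro compact_imp_bounded compact_continuous_image continuous_on_subset[OF h]) auto
  then obtain K where K: "\<And>y. y \<in> {-B..B} \<Longrightarrow> \<bar>h y\<bar> \<le> K"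
    unfolding bounded_iff by (metis imageI real_norm_def)
  show ?thesis
  proof (rule integrable_const_bound)
    show "AE x in M. norm (h (g x)) \<le> K"
      using g(2) by (intro AE_I2) (force intro!: K)
    show "(\<lambda>x. h (g x)) \<in> borel_measurable M"
      using borel_measurable_continuous_on[OF h g(1)] .
  qed
qed

lemma mgf_pos:
  assumes "g \<in> borel_measurable M" "\<And>x. x \<in> space M \<Longrightarrow> \<bar>g x\<bar> \<le> B"
  shows "mgf g t > 0"
proof -
  have "integrable M (\<lambda>x. exp (t * g x))"
    by (rule integrable_bounded_continuous[OF assms, where h="\<lambda>y. exp (t * y)"])
      (auto intro!: continuous_intros)
  then show ?thesis
    using expectation_greater[of "\<lambda>x. exp (t * g x)" 0] by simp
qed

text \<open>
  Dominated convergence for the difference quotients: for bounded \<open>g\<close> the mean value inequality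
  bounds all of them by the same constant.
\<close>

lemma DERIV_mgf:
  assumes g: "g \<in> borel_measurable M" "\<And>x. x \<in> space M \<Longrightarrow> \<bar>g x\<bar> \<le> B"
  shows "(mgf g has_real_derivative expectation (\<lambda>x. g x * exp (t * g x))) (at t)"
  unfolding DERIV_def tendsto_at_iff_sequentially o_def
proof (intro allI impI)
  fix s :: "nat \<Rightarrow> real"
  assume nz: "\<forall>i. s i \<in> UNIV - {0}" and lim: "s \<longlonglongrightarrow> 0"
  obtain S where S: "\<And>n. \<bar>s n\<bar> \<le> S"
    using lim[THEN convergentI, THEN convergent_imp_Bseq] unfolding Bseq_def by auto
  have int: "integrable M (\<lambda>x. exp (r * g x))" for r
    by (rule integrable_bounded_continuous[OF g, where h="\<lambda>y. exp (r * y)"])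
      (auto intro!: continuous_intros)
  have eq: "(mgf g (t + s n) - mgf g t) / s n =
      expectation (\<lambda>x. (exp ((t + s n) * g x) - exp (t * g x)) / s n)" for n
    using int by simp
  show "(\<lambda>n. (mgf g (t + s n) - mgf g t) / s n) \<longlonglongrightarrow> expectation (\<lambda>x. g x * exp (t * g x))"
    unfolding eq
  proof (rule integral_dominated_convergence[where w="\<lambda>_. B * exp ((\<bar>t\<bar> + S) * B)"])
    show "AE x in M. (\<lambda>n. (exp ((t + s n) * g x) - exp (t * g x)) / s n)
        \<longlonglongrightarrow> g x * exp (t * g x)"
    proof (rule AE_I2)
      fix x
      have "((\<lambda>t. exp (t * g x)) has_real_derivative g x * exp (t * g x)) (at t)"
        by (auto intro!: derivative_eq_intros)
      then show "(\<lambda>n. (exp ((t + s n) * g x) - exp (t * g x)) / s n) \<longlonglongrightarrow> g x * exp (t * g x)"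
        using nz lim unfolding DERIV_def tendsto_at_iff_sequentially o_def by blast
    qed
    show "AE x in M. norm ((exp ((t + s n) * g x) - exp (t * g x)) / s n)
        \<le> B * exp ((\<bar>t\<bar> + S) * B)" for n
    proof (rule AE_I2)
      fix x assume x: "x \<in> space M"
      define K where "K = exp ((\<bar>t\<bar> + S) * B)"
      have gB: "\<bar>g x\<bar> \<le> B" using g(2) x by simp
      have S0: "S \<ge> 0" using S[of 0] by linarith
      (* every t + s_n lies in this symmetric interval, on which the derivative is at most B K *)
      have "norm (exp ((t + s n) * g x) - exp (t * g x)) \<le> (B * K) * norm ((t + s n) - t)"
      proof (rule field_differentiable_bound[where S="{-(\<bar>t\<bar> + S)..\<bar>t\<bar> + S}"
            and f="\<lambda>r. exp (r * g x)" and f'="\<lambda>r. g x * exp (r * g x)"])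
        fix r assume r: "r \<in> {-(\<bar>t\<bar> + S)..\<bar>t\<bar> + S}"
        show "((\<lambda>r. exp (r * g x)) has_real_derivative g x * exp (r * g x))
            (at r within {-(\<bar>t\<bar> + S)..\<bar>t\<bar> + S})"
          by (auto intro!: derivative_eq_intros)
        have "r * g x \<le> \<bar>r\<bar> * \<bar>g x\<bar>"
          using abs_ge_self[of "r * g x"] by (simp add: abs_mult)
        also have "\<dots> \<le> (\<bar>t\<bar> + S) * B"
          using r gB by (intro mult_mono) (auto simp: abs_le_iff)
        finally have "exp (r * g x) \<le> K" by (simp add: K_def)
        then show "norm (g x * exp (r * g x)) \<le> B * K"
          using gB by (simp add: abs_mult) (intro mult_mono, auto)
      qed (use S[of n] S0 in \<open>auto simp: abs_le_iff\<close>)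
      then show "norm ((exp ((t + s n) * g x) - exp (t * g x)) / s n) \<le> B * K"
        using nz by (simp add: divide_simps mult_ac)
    qed
  qed (use g in \<open>auto\<close>)
qed

text \<open>
  The numerator of the derivative is the entropy of \<open>exp (t g)\<close> (see \<open>entropy_exp\<close>), so an upper
  bound on the entropy controls the growth of \<open>ln (mgf g t) / t\<close>. The value at \<open>0\<close> from
  which this growth starts is the mean of \<open>g\<close>.
\<close>

lemma log_mgf_quotient:
  assumes g: "g \<in> borel_measurable M" "\<And>x. x \<in> space M \<Longrightarrow> \<bar>g x\<bar> \<le> B"
  shows DERIV_log_mgf_quotient: "t \<noteq> 0 \<Longrightarrow> ((\<lambda>t. ln (mgf g t) / t) has_real_derivative
      (t * expectation (\<lambda>x. g x * exp (t * g x)) - mgf g t * ln (mgf g t)) / (mgf g t * t\<^sup>2)) (at t)"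
    and tendsto_log_mgf_quotient: "((\<lambda>t. ln (mgf g t) / t) \<longlongrightarrow> expectation g) (at_right 0)"
proof -
  have pos: "mgf g t > 0" for t
    by (rule mgf_pos[OF g])
  have D: "((\<lambda>t. ln (mgf g t)) has_real_derivative
      expectation (\<lambda>x. g x * exp (t * g x)) / mgf g t) (at t)" for t
    using DERIV_chain2[OF DERIV_ln[OF pos] DERIV_mgf[OF g], of t] by (simp add: divide_simps)
  show "((\<lambda>t. ln (mgf g t) / t) has_real_derivative
      (t * expectation (\<lambda>x. g x * exp (t * g x)) - mgf g t * ln (mgf g t)) / (mgf g t * t\<^sup>2)) (at t)"
    if "t \<noteq> 0"
    using DERIV_divide[OF D DERIV_ident that] pos[of t] that
    by (simp add: field_simps power2_eq_square)
  have "((\<lambda>h. ln (mgf g h) / h) \<longlongrightarrow> expectation g) (at 0)"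
    using D[of 0] by (simp add: DERIV_def prob_space)
  then show "((\<lambda>t. ln (mgf g t) / t) \<longlongrightarrow> expectation g) (at_right 0)"
    by (rule filterlim_at_split[THEN iffD1, THEN conjunct2])
qed

lemma entropy_exp:
  assumes g: "g \<in> borel_measurable M" "\<And>x. x \<in> space M \<Longrightarrow> \<bar>g x\<bar> \<le> B"
  shows "Ent M (\<lambda>x. (exp (t * g x / 2))\<^sup>2) =
    ereal (t * expectation (\<lambda>x. g x * exp (t * g x)) - mgf g t * ln (mgf g t))"
proof -
  have sq: "(exp (t * y / 2))\<^sup>2 = exp (t * y)" for y :: real
    by (simp add: power2_eq_square flip: exp_add)
  have "integrable M (\<lambda>x. exp (t * g x))"
    by (rule integrable_bounded_continuous[OF g, where h="\<lambda>y. exp (t * y)"])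
      (auto intro!: continuous_intros)
  moreover have "integrable M (\<lambda>x. exp (t * g x) * (t * g x))"
    by (rule integrable_bounded_continuous[OF g, where h="\<lambda>y. exp (t * y) * (t * y)"])
      (auto intro!: continuous_intros)
  moreover have "expectation (\<lambda>x. exp (t * g x) * (t * g x)) =
      t * expectation (\<lambda>x. g x * exp (t * g x))"
    by (simp add: mult_ac flip: integral_mult_right_zero)
  ultimately show ?thesis
    by (simp add: Ent_def sq)
qed

end

text \<open>
  The limit at \<open>0\<close> stands in for the value there: \<open>ln (mgf g t) / t\<close> need not be continuous at \<open>0\<close>
  under the convention \<open>x / 0 = 0\<close>.
\<close>

lemma le_right_limit_of_nonincreasing:
  fixes k :: "real \<Rightarrow> real"
  assumes T: "0 < T"
    and D: "\<And>t. 0 < t \<Longrightarrow> t \<le> T \<Longrightarrow> \<exists>D. (k has_real_derivative D) (at t) \<and> D \<le> 0"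
    and L: "(k \<longlongrightarrow> L) (at_right 0)"
  shows "k T \<le> L"
proof (rule tendsto_lowerbound[OF L])
  have "k T \<le> k t" if "0 < t" "t < T" for t
    by (rule DERIV_nonpos_imp_nonincreasing) (use that D in auto)
  then show "\<forall>\<^sub>F t in at_right 0. k T \<le> k t"
    using T by (auto simp: eventually_at_right_field)
qed simp

section \<open>Entropy inequalities\<close>

context prob_space
begin

text \<open>
  With \<open>S = \<integral> u\<^sup>2\<close>, \<open>s = sqrt S\<close> and \<open>m = \<integral> \<bar>u\<bar>\<close>, the inequality \<open>ln x \<le> x - 1\<close> at \<open>x = s / \<bar>u\<bar>\<close>
  bounds \<open>u\<^sup>2 ln (u\<^sup>2 / S)\<close> below by \<open>2 u\<^sup>2 - 2 s \<bar>u\<bar>\<close>. Integration gives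
  \<open>Ent (u\<^sup>2) \<ge> 2 s\<^sup>2 - 2 s m\<close>, and this exceeds \<open>s\<^sup>2 - m\<^sup>2\<close> by \<open>(s - m)\<^sup>2\<close>.
  Square integrability comes for free, since the entropy is infinite without it.
\<close>

lemma variance_le_entropy:
  fixes u :: "'a \<Rightarrow> real"
  assumes u: "integrable M u" and K: "K \<ge> 0" and ent: "Ent M (\<lambda>x. (u x)\<^sup>2) \<le> ereal K"
  shows "integrable M (\<lambda>x. (u x)\<^sup>2)"
    and "expectation (\<lambda>x. (u x)\<^sup>2) - (expectation (\<lambda>x. \<bar>u x\<bar>))\<^sup>2 \<le> K"
proof -
  have int: "integrable M (\<lambda>x. (u x)\<^sup>2)" "integrable M (\<lambda>x. (u x)\<^sup>2 * ln ((u x)\<^sup>2))"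
    using ent by (auto simp: Ent_def split: if_splits)
  then show "integrable M (\<lambda>x. (u x)\<^sup>2)" by simp
  define S where "S = expectation (\<lambda>x. (u x)\<^sup>2)"
  define s where "s = sqrt S"
  define m where "m = expectation (\<lambda>x. \<bar>u x\<bar>)"
  have S0: "S \<ge> 0" by (simp add: S_def)
  have s2: "s\<^sup>2 = S" using S0 by (simp add: s_def)
  have ent': "expectation (\<lambda>x. (u x)\<^sup>2 * ln ((u x)\<^sup>2)) - S * ln S \<le> K"
    using ent int by (simp add: Ent_def S_def)
  show "expectation (\<lambda>x. (u x)\<^sup>2) - (expectation (\<lambda>x. \<bar>u x\<bar>))\<^sup>2 \<le> K"
  proof (cases "S = 0")
    case True
    then show ?thesis
      using K unfolding S_def by (smt (verit) zero_le_power2)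
  next
    case False
    then have s: "s > 0" using S0 by (simp add: s_def)
    have pw: "2 * (u x)\<^sup>2 - 2 * s * \<bar>u x\<bar> \<le> (u x)\<^sup>2 * ln ((u x)\<^sup>2) - ln S * (u x)\<^sup>2" for x
    proof (cases "u x = 0")
      case False
      define a where "a = \<bar>u x\<bar>"
      have a: "a > 0" "(u x)\<^sup>2 = a\<^sup>2" using False by (auto simp: a_def)
      have "ln (s / a) \<le> s / a - 1"
        by (rule ln_le_minus_one) (use s a in simp)
      then have "1 - s / a \<le> ln a - ln s"
        using s a by (simp add: ln_div)
      then have "2 * a\<^sup>2 * (1 - s / a) \<le> 2 * a\<^sup>2 * (ln a - ln s)"
        by (rule mult_left_mono) simp
      also have "2 * a\<^sup>2 * (1 - s / a) = 2 * a\<^sup>2 - 2 * s * a"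
        using a by (simp add: power2_eq_square field_simps)
      also have "2 * a\<^sup>2 * (ln a - ln s) = a\<^sup>2 * ln (a\<^sup>2) - ln (s\<^sup>2) * a\<^sup>2"
        using a s by (simp add: ln_realpow algebra_simps)
      finally show ?thesis
        by (simp only: a(2) s2 flip: a_def)
    qed simp
    have "expectation (\<lambda>x. 2 * (u x)\<^sup>2 - 2 * s * \<bar>u x\<bar>)
        \<le> expectation (\<lambda>x. (u x)\<^sup>2 * ln ((u x)\<^sup>2) - ln S * (u x)\<^sup>2)"
      by (rule integral_mono) (use int u pw in auto)
    then have "2 * S - 2 * s * m \<le> expectation (\<lambda>x. (u x)\<^sup>2 * ln ((u x)\<^sup>2)) - ln S * S"
      using int u by (simp add: S_def m_def)
    moreover have "0 \<le> (s - m)\<^sup>2" by simp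
    ultimately have "S - m\<^sup>2 \<le> K"
      using ent' s2 by (simp add: power2_diff mult_ac)
    then show ?thesis
      by (simp add: S_def m_def)
  qed
qed

text \<open>
  This removes the absolute value from \<open>variance_le_entropy\<close>. The variance of \<open>g\<close> does not change
  under \<open>g \<mapsto> g + n\<close>, while \<open>\<bar>g + n\<bar>\<close> and \<open>g + n\<close> differ only where \<open>g < - n\<close>. The
  mean \<open>d n\<close> of the difference satisfies \<open>n * d n \<longlonglongrightarrow> 0\<close>, which is needed because \<open>d n\<close> is
  multiplied by the mean of \<open>g + n\<close> when the square is expanded.
\<close>

lemma second_moment_le_of_shifts:
  fixes g :: "'a \<Rightarrow> real"
  assumes g: "integrable M g" "integrable M (\<lambda>x. (g x)\<^sup>2)"
    and shift: "\<And>n. expectation (\<lambda>x. (g x + real n)\<^sup>2) - (expectation (\<lambda>x. \<bar>g x + real n\<bar>))\<^sup>2 \<le> K"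
  shows "expectation (\<lambda>x. (g x)\<^sup>2) \<le> (expectation g)\<^sup>2 + K"
proof -
  define d where "d n = expectation (\<lambda>x. \<bar>g x + real n\<bar> - (g x + real n))" for n
  have nd: "(\<lambda>n. real n * d n) \<longlonglongrightarrow> 0"
  proof -
    have "(\<lambda>n. expectation (\<lambda>x. real n * (\<bar>g x + real n\<bar> - (g x + real n)))) \<longlonglongrightarrow> expectation (\<lambda>x. 0)"
    proof (rule integral_dominated_convergence[where w="\<lambda>x. 2 * (g x)\<^sup>2"])
      show "AE x in M. (\<lambda>n. real n * (\<bar>g x + real n\<bar> - (g x + real n))) \<longlonglongrightarrow> 0"
      proof (rule AE_I2)
        fix x
        have "\<forall>\<^sub>F n in sequentially. 0 = real n * (\<bar>g x + real n\<bar> - (g x + real n))"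
          using eventually_ge_at_top[of "nat \<lceil>\<bar>g x\<bar>\<rceil>"]
        proof eventually_elim
          case (elim n)
          then have "\<bar>g x\<bar> \<le> real n" by linarith
          then show ?case by (simp add: abs_le_iff)
        qed
        then show "(\<lambda>n. real n * (\<bar>g x + real n\<bar> - (g x + real n))) \<longlonglongrightarrow> 0"
          by (rule Lim_transform_eventually[OF tendsto_const])
      qed
      show "AE x in M. norm (real n * (\<bar>g x + real n\<bar> - (g x + real n))) \<le> 2 * (g x)\<^sup>2" for n
      proof (rule AE_I2)
        fix x
        show "norm (real n * (\<bar>g x + real n\<bar> - (g x + real n))) \<le> 2 * (g x)\<^sup>2"
        proof (cases "g x + real n \<ge> 0")
          case False
          (* here n < - g x, so both factors are dominated by multiples of - g x *)
          have "real n * (- 2 * (g x + real n)) \<le> (- g x) * (- 2 * g x)"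
            by (rule mult_mono) (use False in auto)
          with False show ?thesis
            by (simp add: abs_mult power2_eq_square)
        qed simp
      qed
    qed (use g in \<open>auto simp: borel_measurable_integrable\<close>)
    then show ?thesis
      by (simp add: d_def)
  qed
  have d: "d \<longlonglongrightarrow> 0"
  proof -
    have "(\<lambda>n. inverse (real n) * (real n * d n)) \<longlonglongrightarrow> 0 * 0"
      by (intro tendsto_mult nd lim_inverse_n)
    moreover have "\<forall>\<^sub>F n in sequentially. inverse (real n) * (real n * d n) = d n"
      using eventually_gt_at_top[of 0] by eventually_elim simp
    ultimately show ?thesis
      using Lim_transform_eventually by fastforce
  qed
  define a where "a = expectation g"
  define S where "S = expectation (\<lambda>x. (g x)\<^sup>2)"
  have "S - a\<^sup>2 - (2 * a * d n + 2 * (real n * d n) + (d n)\<^sup>2) \<le> K" for n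
  proof -
    have "expectation (\<lambda>x. (g x + real n)\<^sup>2) = S + 2 * a * real n + (real n)\<^sup>2"
      using g by (simp add: power2_sum S_def a_def prob_space)
    moreover have "expectation (\<lambda>x. \<bar>g x + real n\<bar>) = a + real n + d n"
      using g by (simp add: a_def d_def prob_space)
    ultimately show ?thesis
      using shift[of n] by (simp add: power2_eq_square algebra_simps)
  qed
  moreover have "(\<lambda>n. S - a\<^sup>2 - (2 * a * d n + 2 * (real n * d n) + (d n)\<^sup>2))
      \<longlonglongrightarrow> S - a\<^sup>2 - (2 * a * 0 + 2 * 0 + 0\<^sup>2)"
    by (intro tendsto_intros nd d)
  ultimately have "S - a\<^sup>2 - (2 * a * 0 + 2 * 0 + 0\<^sup>2) \<le> K"
    by (intro LIMSEQ_le_const2) auto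
  then show ?thesis
    by (simp add: S_def a_def)
qed

text \<open>
  The Gibbs variational principle: entropy and the logarithm of the exponential integral are
  convex conjugates. It follows from \<open>1 + y \<le> exp y\<close> at \<open>y = W - ln Z - (t g - ln H)\<close>, where
  \<open>Z\<close> and \<open>H\<close> normalise \<open>exp W\<close> and \<open>exp (t g)\<close> to probability densities. Multiplied by
  \<open>exp (t g)\<close>, the constant term and the exponential have the same integral \<open>H\<close> and cancel.
\<close>

lemma entropy_duality:
  fixes W :: "'a \<Rightarrow> real"
  assumes g: "g \<in> borel_measurable M" "\<And>x. x \<in> space M \<Longrightarrow> \<bar>g x\<bar> \<le> B"
    and W: "W \<in> borel_measurable M" "\<And>x. x \<in> space M \<Longrightarrow> 0 \<le> W x"
      "integrable M (\<lambda>x. exp (W x))"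
  shows "integrable M (\<lambda>x. W x * exp (t * g x))"
    and "expectation (\<lambda>x. W x * exp (t * g x)) \<le>
      (t * expectation (\<lambda>x. g x * exp (t * g x)) - mgf g t * ln (mgf g t))
        + mgf g t * ln (expectation (\<lambda>x. exp (W x)))"
proof -
  have int_e: "integrable M (\<lambda>x. exp (t * g x))"
    by (rule integrable_bounded_continuous[OF g, where h="\<lambda>y. exp (t * y)"])
      (auto intro!: continuous_intros)
  have int_ge: "integrable M (\<lambda>x. g x * exp (t * g x))"
    by (rule integrable_bounded_continuous[OF g, where h="\<lambda>y. y * exp (t * y)"])
      (auto intro!: continuous_intros)
  show int_We: "integrable M (\<lambda>x. W x * exp (t * g x))"
  proof (rule Bochner_Integration.integrable_bound)
    show "integrable M (\<lambda>x. exp (\<bar>t\<bar> * B) * exp (W x))"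
      using W by simp
    show "AE x in M. norm (W x * exp (t * g x)) \<le> norm (exp (\<bar>t\<bar> * B) * exp (W x))"
    proof (rule AE_I2)
      fix x assume x: "x \<in> space M"
      have "t * g x \<le> \<bar>t\<bar> * \<bar>g x\<bar>"
        using abs_ge_self[of "t * g x"] by (simp add: abs_mult)
      also have "\<dots> \<le> \<bar>t\<bar> * B"
        using g(2)[OF x] by (intro mult_left_mono) auto
      finally have "exp (t * g x) \<le> exp (\<bar>t\<bar> * B)" by simp
      moreover have "W x \<le> exp (W x)"
        using exp_ge_add_one_self[of "W x"] by linarith
      ultimately have "W x * exp (t * g x) \<le> exp (W x) * exp (\<bar>t\<bar> * B)"
        by (intro mult_mono) auto
      then show "norm (W x * exp (t * g x)) \<le> norm (exp (\<bar>t\<bar> * B) * exp (W x))"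
        using W(2)[OF x] by (simp add: mult_ac)
    qed
  qed (use g W in measurable)
  define H where "H = mgf g t"
  define Z where "Z = expectation (\<lambda>x. exp (W x))"
  have H: "H > 0"
    unfolding H_def by (rule mgf_pos[OF g])
  have Z: "Z > 0"
    using expectation_greater[of "\<lambda>x. exp (W x)" 0] W by (simp add: Z_def)
  have pw: "W x * exp (t * g x) - ln Z * exp (t * g x) \<le>
      t * (g x * exp (t * g x)) - ln H * exp (t * g x) - exp (t * g x) + H / Z * exp (W x)" for x
  proof -
    define a where "a = exp (t * g x)"
    have "1 + (W x - ln Z + ln H - t * g x) \<le> exp (W x - ln Z + ln H - t * g x)"
      by (rule exp_ge_add_one_self)
    then have "a * (1 + (W x - ln Z + ln H - t * g x)) \<le> a * exp (W x - ln Z + ln H - t * g x)"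
      by (rule mult_left_mono) (simp add: a_def)
    also have "a * exp (W x - ln Z + ln H - t * g x) = H / Z * exp (W x)"
      using H Z by (simp add: a_def exp_diff exp_add)
    finally show ?thesis
      unfolding a_def by (simp add: algebra_simps)
  qed
  have "expectation (\<lambda>x. W x * exp (t * g x) - ln Z * exp (t * g x)) \<le>
      expectation (\<lambda>x. t * (g x * exp (t * g x)) - ln H * exp (t * g x) - exp (t * g x)
        + H / Z * exp (W x))"
    by (rule integral_mono) (use int_e int_ge int_We W pw in auto)
  then have "expectation (\<lambda>x. W x * exp (t * g x)) - ln Z * H \<le>
      t * expectation (\<lambda>x. g x * exp (t * g x)) - ln H * H - H + H / Z * Z"
    using int_e int_ge int_We W by (simp add: H_def Z_def)
  then show "expectation (\<lambda>x. W x * exp (t * g x)) \<le>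
      (t * expectation (\<lambda>x. g x * exp (t * g x)) - mgf g t * ln (mgf g t))
        + mgf g t * ln (expectation (\<lambda>x. exp (W x)))"
    using Z by (simp add: H_def Z_def mult_ac)
qed

text \<open>
  Fatou's lemma in the form in which truncations are removed.
\<close>

lemma nn_integral_exp_le_of_limit:
  fixes h :: "nat \<Rightarrow> 'a \<Rightarrow> real"
  assumes h: "\<And>n. h n \<in> borel_measurable M"
    and lim: "\<And>x. x \<in> space M \<Longrightarrow> (\<lambda>n. h n x) \<longlonglongrightarrow> h' x"
    and le: "\<And>n. (\<integral>\<^sup>+ x. ennreal (exp (h n x)) \<partial>M) \<le> ennreal (C n)"
    and C: "C \<longlonglongrightarrow> C'"
  shows "(\<integral>\<^sup>+ x. ennreal (exp (h' x)) \<partial>M) \<le> ennreal C'"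
proof -
  have "liminf (\<lambda>n. ennreal (exp (h n x))) = ennreal (exp (h' x))" if "x \<in> space M" for x
    by (intro lim_imp_Liminf tendsto_ennrealI tendsto_exp lim that) simp
  then have "(\<integral>\<^sup>+ x. ennreal (exp (h' x)) \<partial>M) = (\<integral>\<^sup>+ x. liminf (\<lambda>n. ennreal (exp (h n x))) \<partial>M)"
    by (intro nn_integral_cong) simp
  also have "\<dots> \<le> liminf (\<lambda>n. \<integral>\<^sup>+ x. ennreal (exp (h n x)) \<partial>M)"
    by (rule nn_integral_liminf) (use h in measurable)
  also have "\<dots> \<le> liminf (\<lambda>n. ennreal (C n))"
    by (rule Liminf_mono) (simp add: le)
  also have "\<dots> = ennreal C'"
    by (intro lim_imp_Liminf tendsto_ennrealI C) simp
  finally show ?thesis .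
qed

lemma integrable_exp_of_nn_integral_le:
  assumes "h \<in> borel_measurable M" "(\<integral>\<^sup>+ x. ennreal (exp (h x)) \<partial>M) \<le> ennreal C" "C \<ge> 0"
  shows "integrable M (\<lambda>x. exp (h x))" "expectation (\<lambda>x. exp (h x)) \<le> C"
proof -
  show int: "integrable M (\<lambda>x. exp (h x))"
    by (rule integrableI_nonneg) (use assms in \<open>auto intro: le_less_trans\<close>)
  show "expectation (\<lambda>x. exp (h x)) \<le> C"
    using assms nn_integral_eq_integral[OF int] by simp
qed

end

text \<open>
  The functions \<open>y \<mapsto> N * arctan (y / N)\<close> are bounded and smooth, have slope in \<open>(0, 1]\<close>, and
  tend to the identity as \<open>N\<close> grows.
\<close>

lemma arctan_truncation:
  fixes y :: real
  shows abs_arctan_le: "\<bar>arctan y\<bar> \<le> \<bar>y\<bar>"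
    and tendsto_arctan_truncation:
      "(\<lambda>n. real (Suc n) * arctan (y / real (Suc n))) \<longlonglongrightarrow> y"
proof -
  have "norm (arctan y - arctan 0) \<le> 1 * norm (y - 0)"
  proof (rule field_differentiable_bound[where S=UNIV and f'="\<lambda>y. inverse (1 + y\<^sup>2)"])
    show "norm (inverse (1 + z\<^sup>2)) \<le> 1" for z :: real
      by (simp add: inverse_le_1_iff)
  qed (auto intro!: DERIV_arctan)
  then show "\<bar>arctan y\<bar> \<le> \<bar>y\<bar>" by simp
  show "(\<lambda>n. real (Suc n) * arctan (y / real (Suc n))) \<longlonglongrightarrow> y"
  proof (cases "y = 0")
    case False
    have "((\<lambda>h. arctan h / h) \<longlongrightarrow> 1) (at (0::real))"
      using DERIV_arctan[of 0] by (simp add: DERIV_def)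
    moreover have "(\<lambda>n. y / real (Suc n)) \<longlonglongrightarrow> 0"
      using LIMSEQ_Suc[OF lim_const_over_n[of y]] by simp
    then have "filterlim (\<lambda>n. y / real (Suc n)) (at 0) sequentially"
      using False by (simp add: filterlim_at)
    ultimately have "(\<lambda>n. arctan (y / real (Suc n)) / (y / real (Suc n))) \<longlonglongrightarrow> 1"
      by (rule filterlim_compose)
    from tendsto_mult_left[OF this, of y] show ?thesis
      using False by (simp add: mult.commute)
  qed simp
qed

section \<open>The logarithmic Sobolev inequality and the Poincare inequality\<close>

locale log_sobolev_space = prob_space M for M :: "(real^'n) measure" +
  fixes G :: "(real^'n) set" and c :: real
  assumes open_G: "open G"
    and sets_M: "sets M = sets (restrict_space borel G)"
    and c_pos: "c > 0"
    and lsi: "log_sobolev G M c"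
begin

lemma space_M [simp]: "space M = G"
  using sets_eq_imp_space_eq[OF sets_M] by (simp add: space_restrict_space)

lemma prob_G [simp]: "prob G = 1"
  using prob_space by simp

lemma measurable_continuous_on:
  fixes h :: "real^'n \<Rightarrow> 'b::topological_space"
  shows "continuous_on G h \<Longrightarrow> h \<in> borel_measurable M"
  using borel_measurable_continuous_on_restrict measurable_cong_sets[OF sets_M refl] by blast

lemma has_C1_gradient_measurable:
  assumes "has_C1_gradient G u w"
  shows "u \<in> borel_measurable M" "w \<in> borel_measurable M"
  using assms has_C1_gradient_imp_continuous_on[OF assms]
  by (auto intro!: measurable_continuous_on simp: has_C1_gradient_def)

text \<open>
  For continuously differentiable functions the generalized modulus of the gradient is the
  length of the gradient, and the extended integral becomes an ordinary one.
\<close>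

lemma Ent_square_le:
  assumes u: "has_C1_gradient G u w" and int: "integrable M (\<lambda>x. (norm (w x))\<^sup>2)"
  shows "Ent M (\<lambda>x. (u x)\<^sup>2) \<le> ereal (2 * c * expectation (\<lambda>x. (norm (w x))\<^sup>2))"
proof -
  have "locally_lipschitz_on G u"
    using u open_G by (intro locally_lipschitz_onI[of G u w]) (auto simp: has_C1_gradient_def)
  then have "Ent M (\<lambda>x. (u x)\<^sup>2) \<le> ereal (2 * c) * enn2ereal (\<integral>\<^sup>+ x. (grad_norm u x)\<^sup>2 \<partial>M)"
    using lsi by (simp add: log_sobolev_def)
  also have "(\<integral>\<^sup>+ x. (grad_norm u x)\<^sup>2 \<partial>M) = (\<integral>\<^sup>+ x. ennreal ((norm (w x))\<^sup>2) \<partial>M)"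
  proof (rule nn_integral_cong)
    fix x assume "x \<in> space M"
    then have D: "(u has_derivative (\<lambda>v. w x \<bullet> v)) (at x)"
      using u by (auto simp: has_C1_gradient_def)
    then have "u differentiable (at x)"
      by (auto simp: differentiable_def)
    then show "(grad_norm u x)\<^sup>2 = ennreal ((norm (w x))\<^sup>2)"
      by (simp add: grad_norm_def gradient_eqI[OF D] ennreal_power)
  qed
  also have "\<dots> = ennreal (expectation (\<lambda>x. (norm (w x))\<^sup>2))"
    by (rule nn_integral_eq_integral[OF int]) simp
  finally show ?thesis
    by simp
qed

text \<open>
  The inequality is applied to the shifts \<open>g + n\<close>, which share the gradient of \<open>g\<close>.
\<close>

lemma poincare:
  assumes g: "has_C1_gradient G g w" and int: "integrable M g" "integrable M (\<lambda>x. (norm (w x))\<^sup>2)"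
  shows "integrable M (\<lambda>x. (g x)\<^sup>2)"
    and "expectation (\<lambda>x. (g x)\<^sup>2) \<le>
      (expectation g)\<^sup>2 + 2 * c * expectation (\<lambda>x. (norm (w x))\<^sup>2)"
proof -
  let ?K = "2 * c * expectation (\<lambda>x. (norm (w x))\<^sup>2)"
  have K: "?K \<ge> 0" using c_pos by simp
  have ent: "Ent M (\<lambda>x. (g x + real n)\<^sup>2) \<le> ereal ?K" for n
  proof (rule Ent_square_le[OF _ int(2)])
    have "((\<lambda>y. y + real n) has_real_derivative 1) (at y)" for y
      by (auto intro!: derivative_eq_intros)
    then show "has_C1_gradient G (\<lambda>x. g x + real n) w"
      using has_C1_gradient_compose[OF g, of "\<lambda>y. y + real n" "\<lambda>_. 1"] by simp
  qed
  have int_n: "integrable M (\<lambda>x. g x + real n)" for n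
    using int by simp
  note shift = variance_le_entropy[OF int_n K ent]
  show "integrable M (\<lambda>x. (g x)\<^sup>2)"
    using shift(1)[of 0] by simp
  then show "expectation (\<lambda>x. (g x)\<^sup>2) \<le> (expectation g)\<^sup>2 + ?K"
    by (intro second_moment_le_of_shifts int shift(2))
qed

section \<open>Exponential integrability\<close>

text \<open>
  The function \<open>exp (t g / 2)\<close> has gradient \<open>t / 2 * exp (t g / 2) * w\<close>; the factor \<open>c t\<^sup>2 / 2\<close> is
  \<open>2 c * (t / 2)\<^sup>2\<close>.
\<close>

lemma log_sobolev_exp:
  assumes g: "has_C1_gradient G g w" and B: "\<And>x. x \<in> G \<Longrightarrow> \<bar>g x\<bar> \<le> B"
    and int: "integrable M (\<lambda>x. (norm (w x))\<^sup>2 * exp (t * g x))"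
  shows "t * expectation (\<lambda>x. g x * exp (t * g x)) - mgf g t * ln (mgf g t) \<le>
    c * t\<^sup>2 / 2 * expectation (\<lambda>x. (norm (w x))\<^sup>2 * exp (t * g x))"
proof -
  have u: "has_C1_gradient G (\<lambda>x. exp (t * g x / 2)) (\<lambda>x. (t / 2 * exp (t * g x / 2)) *\<^sub>R w x)"
    by (rule has_C1_gradient_compose[OF g, of "\<lambda>y. exp (t * y / 2)" "\<lambda>y. t / 2 * exp (t * y / 2)"])
      (auto intro!: derivative_eq_intros continuous_intros)
  have norm_eq: "(norm ((t / 2 * exp (t * g x / 2)) *\<^sub>R w x))\<^sup>2 =
      t\<^sup>2 / 4 * ((norm (w x))\<^sup>2 * exp (t * g x))" for x
  proof -
    have "(exp (t * g x / 2))\<^sup>2 = exp (t * g x)"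
      by (simp add: power2_eq_square flip: exp_add)
    then show ?thesis
      by (simp add: power_mult_distrib power_divide)
  qed
  have "Ent M (\<lambda>x. (exp (t * g x / 2))\<^sup>2) \<le>
      ereal (2 * c * expectation (\<lambda>x. t\<^sup>2 / 4 * ((norm (w x))\<^sup>2 * exp (t * g x))))"
    using Ent_square_le[OF u] int by (simp only: norm_eq) simp
  then show ?thesis
    using entropy_exp[of g B t] has_C1_gradient_measurable[OF g] B by simp
qed

text \<open>
  Herbst's argument. Put \<open>H = mgf F t\<close> and let \<open>e\<close> be the entropy of \<open>exp (t F)\<close>. Since
  \<open>\<bar>w\<bar>\<^sup>2 \<le> 4 F\<close>, the logarithmic Sobolev inequality bounds \<open>e\<close> by \<open>2 c t (t H')\<close>, and \<open>t H'\<close> is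
  \<open>e + H ln H\<close>. Hence \<open>(1 - 2 c t) e \<le> 2 c t H ln H\<close>, which says exactly that
  \<open>(1 - 2 c t) * ln H / t\<close> is nonincreasing. Its limit at \<open>0\<close> is the mean of \<open>F\<close>.
\<close>

lemma exp_moment_self_bounding_aux:
  assumes F: "has_C1_gradient G F w"
    and B: "\<And>x. x \<in> G \<Longrightarrow> 0 \<le> F x \<and> F x \<le> B"
    and w: "\<And>x. x \<in> G \<Longrightarrow> (norm (w x))\<^sup>2 \<le> 4 * F x"
    and T: "0 < T" "2 * c * T < 1"
  shows "mgf F T \<le> exp (T / (1 - 2 * c * T) * expectation F)"
proof -
  have bd: "\<And>x. x \<in> space M \<Longrightarrow> \<bar>F x\<bar> \<le> B"
    using B by auto
  note meas = has_C1_gradient_measurable[OF F]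
  define k where "k t = (1 - 2 * c * t) * (ln (mgf F t) / t)" for t
  have "k T \<le> expectation F"
  proof (rule le_right_limit_of_nonincreasing[OF T(1)])
    have "(k \<longlongrightarrow> (1 - 2 * c * 0) * expectation F) (at_right 0)"
      unfolding k_def by (intro tendsto_intros tendsto_log_mgf_quotient[OF meas(1) bd])
    then show "(k \<longlongrightarrow> expectation F) (at_right 0)" by simp
  next
    fix t assume t: "0 < t" "t \<le> T"
    define H where "H = mgf F t"
    define H' where "H' = expectation (\<lambda>x. F x * exp (t * F x))"
    define e where "e = t * H' - H * ln H"
    have H: "H > 0"
      unfolding H_def by (rule mgf_pos[OF meas(1) bd])
    have int_F: "integrable M (\<lambda>x. F x * exp (t * F x))"
      by (rule integrable_bounded_continuous[OF meas(1) bd, where h="\<lambda>y. y * exp (t * y)"])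
        (auto intro!: continuous_intros)
    have w_le: "(norm (w x))\<^sup>2 * exp (t * F x) \<le> 4 * (F x * exp (t * F x))" if "x \<in> G" for x
      using mult_right_mono[OF w[OF that], of "exp (t * F x)"] by simp
    have int_w: "integrable M (\<lambda>x. (norm (w x))\<^sup>2 * exp (t * F x))"
      by (rule Bochner_Integration.integrable_bound[where f="\<lambda>x. 4 * (F x * exp (t * F x))"])
        (use int_F meas w_le B in \<open>auto intro!: AE_I2\<close>)
    have "expectation (\<lambda>x. (norm (w x))\<^sup>2 * exp (t * F x)) \<le>
        expectation (\<lambda>x. 4 * (F x * exp (t * F x)))"
      by (rule integral_mono) (use int_F int_w w_le in auto)
    then have "expectation (\<lambda>x. (norm (w x))\<^sup>2 * exp (t * F x)) \<le> 4 * H'"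
      by (simp add: H'_def)
    then have "c * t\<^sup>2 / 2 * expectation (\<lambda>x. (norm (w x))\<^sup>2 * exp (t * F x)) \<le> c * t\<^sup>2 / 2 * (4 * H')"
      using c_pos by (intro mult_left_mono) auto
    then have "e \<le> 2 * c * t * (t * H')"
      using log_sobolev_exp[OF F _ int_w, of B] bd
      by (simp add: e_def H_def H'_def power2_eq_square)
    also have "t * H' = e + H * ln H"
      by (simp add: e_def)
    finally have e: "(1 - 2 * c * t) * e \<le> 2 * c * t * (H * ln H)"
      by (simp add: algebra_simps)
    have "((\<lambda>t. ln (mgf F t) / t) has_real_derivative e / (H * t\<^sup>2)) (at t)"
      using DERIV_log_mgf_quotient[OF meas(1) bd] t by (simp add: e_def H_def H'_def)
    moreover have "((\<lambda>t. 1 - 2 * c * t) has_real_derivative - 2 * c) (at t)"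
      by (auto intro!: derivative_eq_intros)
    ultimately have D: "(k has_real_derivative
        (- 2 * c) * (ln H / t) + e / (H * t\<^sup>2) * (1 - 2 * c * t)) (at t)"
      unfolding k_def H_def by (intro DERIV_mult)
    have "e / (H * t\<^sup>2) * (1 - 2 * c * t) = ((1 - 2 * c * t) * e) / (H * t\<^sup>2)"
      by simp
    also have "\<dots> \<le> (2 * c * t * (H * ln H)) / (H * t\<^sup>2)"
      using e H by (intro divide_right_mono) auto
    also have "\<dots> = 2 * c * (ln H / t)"
      using H t by (simp add: power2_eq_square field_simps)
    finally show "\<exists>D. (k has_real_derivative D) (at t) \<and> D \<le> 0"
      using D by (intro exI conjI) auto
  qed
  then have "ln (mgf F T) \<le> T / (1 - 2 * c * T) * expectation F"
    using T by (simp add: k_def field_simps)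
  then show ?thesis
    using mgf_pos[OF meas(1) bd, of T] by (metis exp_le_cancel_iff exp_ln)
qed

text \<open>
  Boundedness of \<open>F\<close> is removed with \<open>\<phi> y = y / (1 + y / N)\<close>. This truncation keeps the bound on
  the gradient: with \<open>q = 1 + y / N \<ge> 1\<close> one has \<open>\<phi>' y = 1 / q\<^sup>2\<close>, so
  \<open>(\<phi>' y)\<^sup>2 * y = y / q ^ 4 \<le> y / q = \<phi> y\<close>.
\<close>

lemma exp_moment_self_bounding:
  assumes F: "has_C1_gradient G F w" and F0: "\<And>x. x \<in> G \<Longrightarrow> 0 \<le> F x"
    and w: "\<And>x. x \<in> G \<Longrightarrow> (norm (w x))\<^sup>2 \<le> 4 * F x"
    and int: "integrable M F" and T: "0 < T" "2 * c * T < 1"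
  shows "(\<integral>\<^sup>+ x. ennreal (exp (T * F x)) \<partial>M) \<le>
    ennreal (exp (T / (1 - 2 * c * T) * expectation F))"
proof -
  define N where "N n = real (Suc n)" for n
  have N: "N n > 0" for n by (simp add: N_def)
  define \<phi> where "\<phi> n y = y / (1 + y / N n)" for n and y :: real
  have \<phi>: "0 \<le> \<phi> n y" "\<phi> n y \<le> y" "\<phi> n y \<le> N n" if "y \<ge> 0" for n y
    using that N[of n] by (auto simp: \<phi>_def field_simps)
  have pos: "1 + y / N n > 0" if "y \<ge> 0" for n y
    using that N[of n] by (simp add: add_pos_nonneg)
  have \<phi>F: "has_C1_gradient G (\<lambda>x. \<phi> n (F x)) (\<lambda>x. (1 / (1 + F x / N n)\<^sup>2) *\<^sub>R w x)" for n
  proof (rule has_C1_gradient_compose[OF F, where \<phi>' = "\<lambda>y. 1 / (1 + y / N n)\<^sup>2"])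
    show "(\<phi> n has_real_derivative 1 / (1 + F x / N n)\<^sup>2) (at (F x))" if "x \<in> G" for x
      unfolding \<phi>_def using pos[OF F0[OF that], of n] N[of n]
      by (auto intro!: derivative_eq_intros simp: power2_eq_square field_simps)
    show "continuous_on (F ` G) (\<lambda>y. 1 / (1 + y / N n)\<^sup>2)"
      using pos[OF F0, of _ n] N[of n] by (intro continuous_intros) (auto simp: less_imp_neq[symmetric])
  qed
  have w_le: "(norm ((1 / (1 + F x / N n)\<^sup>2) *\<^sub>R w x))\<^sup>2 \<le> 4 * \<phi> n (F x)" if x: "x \<in> G" for x n
  proof -
    define q where "q = 1 + F x / N n"
    have q: "q \<ge> 1" using F0[OF x] N[of n] by (simp add: q_def)
    have "(norm ((1 / q\<^sup>2) *\<^sub>R w x))\<^sup>2 = (norm (w x))\<^sup>2 / q ^ 4"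
      by (simp add: power_divide flip: power_mult)
    also have "\<dots> \<le> 4 * F x / q ^ 4"
      using q w[OF x] by (intro divide_right_mono) auto
    also have "\<dots> \<le> 4 * F x / q"
      using q F0[OF x] power_increasing[of 1 4 q] by (intro divide_left_mono) auto
    finally show ?thesis
      by (simp add: q_def \<phi>_def)
  qed
  note meas = has_C1_gradient_measurable[OF \<phi>F]
  show ?thesis
  proof (rule nn_integral_exp_le_of_limit[where h="\<lambda>n x. T * \<phi> n (F x)"])
    show "(\<lambda>x. T * \<phi> n (F x)) \<in> borel_measurable M" for n
      using meas by simp
    show "(\<lambda>n. T * \<phi> n (F x)) \<longlonglongrightarrow> T * F x" for x
    proof -
      have "(\<lambda>n. T * (F x / (1 + F x * (1 / N n)))) \<longlonglongrightarrow> T * (F x / (1 + F x * 0))"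
        unfolding N_def
        by (intro tendsto_intros LIMSEQ_Suc[OF lim_1_over_n]) simp
      then show ?thesis by (simp add: \<phi>_def)
    qed
    show "(\<integral>\<^sup>+ x. ennreal (exp (T * \<phi> n (F x))) \<partial>M) \<le>
        ennreal (exp (T / (1 - 2 * c * T) * expectation F))" for n
    proof -
      have bd: "\<bar>\<phi> n (F x)\<bar> \<le> N n" if "x \<in> space M" for x
        using \<phi>[of "F x" n] F0[of x] that by simp
      have "integrable M (\<lambda>x. exp (T * \<phi> n (F x)))"
        by (rule integrable_bounded_continuous[OF meas(1) bd, where h="\<lambda>y. exp (T * y)"])
          (auto intro!: continuous_intros)
      then have "(\<integral>\<^sup>+ x. ennreal (exp (T * \<phi> n (F x))) \<partial>M) = ennreal (mgf (\<lambda>x. \<phi> n (F x)) T)"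
        by (rule nn_integral_eq_integral) simp
      also have "\<dots> \<le> ennreal (exp (T / (1 - 2 * c * T) * expectation (\<lambda>x. \<phi> n (F x))))"
        by (intro ennreal_leI exp_moment_self_bounding_aux[where B="N n", OF \<phi>F _ w_le T]) (use \<phi> F0 in auto)
      also have "\<dots> \<le> ennreal (exp (T / (1 - 2 * c * T) * expectation F))"
      proof -
        have "integrable M (\<lambda>x. \<phi> n (F x))"
          by (rule integrable_const_bound[where B="N n"]) (use bd meas in auto)
        then have "expectation (\<lambda>x. \<phi> n (F x)) \<le> expectation F"
          by (rule integral_mono[OF _ int]) (use \<phi> F0 in auto)
        then show ?thesis
          using T by (intro ennreal_leI) (auto intro!: mult_left_mono divide_right_mono)
      qed
      finally show ?thesis .
    qed
  qed simp
qed

text \<open>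
  Let \<open>W = c l\<^sup>2 V\<close>, \<open>\<beta> = ln (\<integral> exp W)\<close>, \<open>H = mgf g t\<close>, and let \<open>e\<close> be the entropy of
  \<open>exp (t g)\<close>. The logarithmic Sobolev inequality gives \<open>e \<le> r / 2 * \<integral> W exp (t g)\<close> with
  \<open>r = t\<^sup>2 / l\<^sup>2\<close>, and duality bounds the integral by \<open>e + H \<beta>\<close>. For \<open>t \<le> l\<close> the coefficient
  \<open>r / 2\<close> is at most \<open>1 / 2\<close>, so \<open>e\<close> can be absorbed on the left: \<open>e \<le> r H \<beta>\<close>. Therefore
  \<open>ln (mgf g t) / t\<close> has slope at most \<open>\<beta> / l\<^sup>2\<close> on \<open>(0, l]\<close>, and integrating from \<open>0\<close> to \<open>l\<close>
  gives \<open>ln (mgf g l) \<le> l * \<integral> g + \<beta>\<close>. The bound \<open>V\<close> replaces \<open>\<bar>w\<bar>\<^sup>2\<close> so that it can stay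
  fixed while \<open>g\<close> runs through truncations of one function.
\<close>

lemma exp_moment_gradient_aux:
  assumes g: "has_C1_gradient G g w" and B: "\<And>x. x \<in> G \<Longrightarrow> \<bar>g x\<bar> \<le> B"
    and V: "V \<in> borel_measurable M" "\<And>x. x \<in> G \<Longrightarrow> (norm (w x))\<^sup>2 \<le> V x"
      "integrable M (\<lambda>x. exp (c * l\<^sup>2 * V x))"
    and l: "0 < l"
  shows "mgf g l \<le> exp (l * expectation g) * expectation (\<lambda>x. exp (c * l\<^sup>2 * V x))"
proof -
  have bd: "\<And>x. x \<in> space M \<Longrightarrow> \<bar>g x\<bar> \<le> B"
    using B by auto
  note meas = has_C1_gradient_measurable[OF g]
  define W where "W x = c * l\<^sup>2 * V x" for x
  have V0: "0 \<le> V x" if "x \<in> G" for x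
    using V(2)[OF that] zero_le_power2[of "norm (w x)"] by linarith
  have W: "W \<in> borel_measurable M" "\<And>x. x \<in> space M \<Longrightarrow> 0 \<le> W x" "integrable M (\<lambda>x. exp (W x))"
    using V V0 c_pos by (auto simp: W_def [abs_def])
  define Z where "Z = expectation (\<lambda>x. exp (W x))"
  have "expectation (\<lambda>x. 1) \<le> Z"
    unfolding Z_def by (rule integral_mono) (use W in auto)
  then have Z: "Z \<ge> 1" by simp
  define \<beta> where "\<beta> = ln Z"
  have \<beta>: "\<beta> \<ge> 0" using Z by (simp add: \<beta>_def)
  define k where "k t = ln (mgf g t) / t - \<beta> / l\<^sup>2 * t" for t
  have "k l \<le> expectation g"
  proof (rule le_right_limit_of_nonincreasing[OF l])
    have "(k \<longlongrightarrow> expectation g - \<beta> / l\<^sup>2 * 0) (at_right 0)"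
      unfolding k_def by (intro tendsto_intros tendsto_log_mgf_quotient[OF meas(1) bd])
    then show "(k \<longlongrightarrow> expectation g) (at_right 0)" by simp
  next
    fix t assume t: "0 < t" "t \<le> l"
    define H where "H = mgf g t"
    define r where "r = t\<^sup>2 / l\<^sup>2"
    define e where "e = t * expectation (\<lambda>x. g x * exp (t * g x)) - H * ln H"
    have H: "H > 0"
      unfolding H_def by (rule mgf_pos[OF meas(1) bd])
    note dual = entropy_duality[OF meas(1) bd W, of t]
    have w_le: "c * l\<^sup>2 * ((norm (w x))\<^sup>2 * exp (t * g x)) \<le> W x * exp (t * g x)" if "x \<in> G" for x
      using mult_right_mono[OF V(2)[OF that], of "c * l\<^sup>2 * exp (t * g x)"] c_pos
      by (simp add: W_def mult_ac)
    have int_w': "integrable M (\<lambda>x. c * l\<^sup>2 * ((norm (w x))\<^sup>2 * exp (t * g x)))"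
      by (rule Bochner_Integration.integrable_bound[OF dual(1)])
        (use meas w_le W c_pos in \<open>auto intro!: AE_I2 simp: abs_mult\<close>)
    then have int_w: "integrable M (\<lambda>x. (norm (w x))\<^sup>2 * exp (t * g x))"
      using c_pos l by simp
    have "expectation (\<lambda>x. c * l\<^sup>2 * ((norm (w x))\<^sup>2 * exp (t * g x))) \<le>
        expectation (\<lambda>x. W x * exp (t * g x))"
      by (rule integral_mono) (use int_w' dual(1) w_le in auto)
    also have "\<dots> \<le> e + H * \<beta>"
      using dual(2) by (simp add: e_def H_def \<beta>_def Z_def)
    finally have E: "c * l\<^sup>2 * expectation (\<lambda>x. (norm (w x))\<^sup>2 * exp (t * g x)) \<le> e + H * \<beta>"
      by simp
    have "e \<le> c * t\<^sup>2 / 2 * expectation (\<lambda>x. (norm (w x))\<^sup>2 * exp (t * g x))"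
      using log_sobolev_exp[OF g B int_w] by (simp add: e_def H_def)
    also have "\<dots> = t\<^sup>2 / (2 * l\<^sup>2) * (c * l\<^sup>2 * expectation (\<lambda>x. (norm (w x))\<^sup>2 * exp (t * g x)))"
      using l by simp
    also have "\<dots> \<le> t\<^sup>2 / (2 * l\<^sup>2) * (e + H * \<beta>)"
      by (rule mult_left_mono[OF E]) simp
    also have "\<dots> = r * e / 2 + r * (H * \<beta>) / 2"
      by (simp add: r_def distrib_left add_divide_distrib)
    finally have e1: "e \<le> r * e / 2 + r * (H * \<beta>) / 2" .
    have e2: "e \<le> r * (H * \<beta>)"
    proof (cases "e \<ge> 0")
      case True
      have "t\<^sup>2 \<le> l\<^sup>2" using t by (intro power_mono) auto
      then have "r * e \<le> 1 * e"
        using True l by (intro mult_right_mono) (auto simp: r_def)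
      with e1 show ?thesis by linarith
    next
      case False
      have "0 \<le> r * (H * \<beta>)" using H \<beta> by (simp add: r_def)
      with False show ?thesis by linarith
    qed
    have "((\<lambda>t. ln (mgf g t) / t) has_real_derivative e / (H * t\<^sup>2)) (at t)"
      using DERIV_log_mgf_quotient[OF meas(1) bd] t by (simp add: e_def H_def)
    then have D: "(k has_real_derivative e / (H * t\<^sup>2) - \<beta> / l\<^sup>2) (at t)"
      unfolding k_def by (intro DERIV_diff DERIV_cmult_Id)
    have "e / (H * t\<^sup>2) \<le> (r * (H * \<beta>)) / (H * t\<^sup>2)"
      using e2 H by (intro divide_right_mono) auto
    also have "\<dots> = \<beta> / l\<^sup>2"
      using H t by (simp add: r_def)
    finally show "\<exists>D. (k has_real_derivative D) (at t) \<and> D \<le> 0"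
      using D by (intro exI conjI) auto
  qed
  then have "ln (mgf g l) \<le> l * expectation g + \<beta>"
    using l by (simp add: k_def field_simps power2_eq_square)
  then have "mgf g l \<le> exp (l * expectation g + \<beta>)"
    using mgf_pos[OF meas(1) bd, of l] by (metis exp_le_cancel_iff exp_ln)
  then show ?thesis
    using Z by (simp add: exp_add \<beta>_def Z_def W_def)
qed

text \<open>
  The truncations \<open>N * arctan (f / N)\<close> are no longer centred, but they are dominated by \<open>\<bar>f\<bar>\<close>, so
  their means tend to that of \<open>f\<close>.
\<close>

lemma exp_moment_gradient:
  assumes f: "has_C1_gradient G f w" and int: "integrable M f" and mean: "expectation f = 0"
    and l: "0 < l" and expw: "integrable M (\<lambda>x. exp (c * l\<^sup>2 * (norm (w x))\<^sup>2))"
  shows "(\<integral>\<^sup>+ x. ennreal (exp (l * f x)) \<partial>M) \<le>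
    ennreal (expectation (\<lambda>x. exp (c * l\<^sup>2 * (norm (w x))\<^sup>2)))"
proof -
  define N where "N n = real (Suc n)" for n
  have N: "N n > 0" for n by (simp add: N_def)
  define \<phi> where "\<phi> n y = N n * arctan (y / N n)" for n and y :: real
  define Z where "Z = expectation (\<lambda>x. exp (c * l\<^sup>2 * (norm (w x))\<^sup>2))"
  have \<phi>_lim: "(\<lambda>n. \<phi> n y) \<longlonglongrightarrow> y" for y
    unfolding \<phi>_def N_def by (rule tendsto_arctan_truncation)
  have \<phi>_le: "\<bar>\<phi> n y\<bar> \<le> \<bar>y\<bar>" for n y
    using mult_left_mono[OF abs_arctan_le[of "y / N n"], of "N n"] N[of n]
    by (simp add: \<phi>_def abs_mult)
  have \<phi>_bd: "\<bar>\<phi> n y\<bar> \<le> N n * pi" for n y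
  proof -
    have "\<bar>arctan (y / N n)\<bar> \<le> pi"
      using arctan_bounded[of "y / N n"] pi_gt_zero by linarith
    then show ?thesis
      using N[of n] by (simp add: \<phi>_def abs_mult)
  qed
  have \<phi>f: "has_C1_gradient G (\<lambda>x. \<phi> n (f x)) (\<lambda>x. inverse (1 + (f x / N n)\<^sup>2) *\<^sub>R w x)" for n
  proof (rule has_C1_gradient_compose[OF f, where \<phi>' = "\<lambda>y. inverse (1 + (y / N n)\<^sup>2)"])
    show "(\<phi> n has_real_derivative inverse (1 + (f x / N n)\<^sup>2)) (at (f x))" for x
      unfolding \<phi>_def using N[of n] by (auto intro!: derivative_eq_intros)
    have "1 + (y / N n)\<^sup>2 \<noteq> 0" for y
      by (metis add_pos_nonneg less_numeral_extra(3) zero_le_power2 zero_less_one)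
    then show "continuous_on (f ` G) (\<lambda>y. inverse (1 + (y / N n)\<^sup>2))"
      using N[of n] by (intro continuous_intros) auto
  qed
  note meas = has_C1_gradient_measurable[OF \<phi>f]
  have w_le: "(norm (inverse (1 + (f x / N n)\<^sup>2) *\<^sub>R w x))\<^sup>2 \<le> (norm (w x))\<^sup>2" for x n
  proof (rule power_mono)
    have "inverse (1 + (f x / N n)\<^sup>2) \<le> 1"
      by (simp add: inverse_le_1_iff)
    then show "norm (inverse (1 + (f x / N n)\<^sup>2) *\<^sub>R w x) \<le> norm (w x)"
      using mult_right_mono[of "inverse (1 + (f x / N n)\<^sup>2)" 1 "norm (w x)"] by simp
  qed simp
  have mean_lim: "(\<lambda>n. expectation (\<lambda>x. \<phi> n (f x))) \<longlonglongrightarrow> 0"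
    unfolding mean[symmetric]
    by (rule integral_dominated_convergence[where w="\<lambda>x. \<bar>f x\<bar>"])
      (use int meas \<phi>_lim \<phi>_le in auto)
  show ?thesis
    unfolding Z_def[symmetric]
  proof (rule nn_integral_exp_le_of_limit[where h="\<lambda>n x. l * \<phi> n (f x)"
        and C="\<lambda>n. exp (l * expectation (\<lambda>x. \<phi> n (f x))) * Z"])
    show "(\<lambda>x. l * \<phi> n (f x)) \<in> borel_measurable M" for n
      using meas by simp
    show "(\<lambda>n. l * \<phi> n (f x)) \<longlonglongrightarrow> l * f x" for x
      by (intro tendsto_intros \<phi>_lim)
    have "(\<lambda>n. exp (l * expectation (\<lambda>x. \<phi> n (f x))) * Z) \<longlonglongrightarrow> exp (l * 0) * Z"
      by (intro tendsto_intros mean_lim)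
    then show "(\<lambda>n. exp (l * expectation (\<lambda>x. \<phi> n (f x))) * Z) \<longlonglongrightarrow> Z"
      by simp
    show "(\<integral>\<^sup>+ x. ennreal (exp (l * \<phi> n (f x))) \<partial>M) \<le>
        ennreal (exp (l * expectation (\<lambda>x. \<phi> n (f x))) * Z)" for n
    proof -
      have "integrable M (\<lambda>x. exp (l * \<phi> n (f x)))"
        by (rule integrable_bounded_continuous[OF meas(1) \<phi>_bd, where h="\<lambda>y. exp (l * y)"])
          (auto intro!: continuous_intros)
      then have "(\<integral>\<^sup>+ x. ennreal (exp (l * \<phi> n (f x))) \<partial>M) = ennreal (mgf (\<lambda>x. \<phi> n (f x)) l)"
        by (rule nn_integral_eq_integral) simp
      also have "\<dots> \<le> ennreal (exp (l * expectation (\<lambda>x. \<phi> n (f x))) * Z)"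
        unfolding Z_def
        by (intro ennreal_leI exp_moment_gradient_aux[OF \<phi>f \<phi>_bd _ w_le expw l])
          (use has_C1_gradient_measurable(2)[OF f] in measurable)
      finally show ?thesis .
    qed
  qed
qed

end

section \<open>Second order concentration\<close>

lemma hessian_gradients:
  fixes f :: "real^'n \<Rightarrow> real"
  shows gradient_partial_deriv_eq: "gradient (partial_deriv j f) x = hessian f x *v axis j 1"
    and hs_norm_hessian: "(hs_norm (hessian f x))\<^sup>2 =
      (\<Sum>j\<in>UNIV. (norm (gradient (partial_deriv j f) x))\<^sup>2)"
    and norm_gradient: "(norm (gradient f x))\<^sup>2 = (\<Sum>j\<in>UNIV. (partial_deriv j f x)\<^sup>2)"
proof -
  have sq: "(norm (v :: real^'n))\<^sup>2 = (\<Sum>i\<in>UNIV. (v $ i)\<^sup>2)" for v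
    by (simp add: norm_vec_def L2_set_def sum_nonneg)
  show "gradient (partial_deriv j f) x = hessian f x *v axis j 1"
    by (simp add: matrix_vector_mul_component matrix_vector_mult_basis column_def gradient_def
        hessian_def vec_eq_iff)
  show "(norm (gradient f x))\<^sup>2 = (\<Sum>j\<in>UNIV. (partial_deriv j f x)\<^sup>2)"
    by (simp add: sq gradient_def)
  show "(hs_norm (hessian f x))\<^sup>2 = (\<Sum>j\<in>UNIV. (norm (gradient (partial_deriv j f) x))\<^sup>2)"
    unfolding sq by (subst sum.swap) (simp add: hs_norm_def hessian_def gradient_def sum_nonneg)
qed

lemma norm_matrix_vector_le_op_norm:
  "norm (A *v v) \<le> op_norm A * norm (v :: real^'n)"
  unfolding op_norm_def by (rule onorm) (rule matrix_vector_mul_bounded_linear)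

text \<open>
  The \<open>i\<close>-th partial derivative of \<open>\<Sum>j. (\<partial>\<^sub>j f)\<^sup>2\<close> is \<open>2 * (\<Sum>j. \<partial>\<^sub>i \<partial>\<^sub>j f * \<partial>\<^sub>j f)\<close>. The order
  of differentiation in \<open>hessian\<close> is the one that makes this twice the \<open>i\<close>-th entry of the
  Hessian applied to the gradient.
\<close>

lemma has_C1_gradient_norm_gradient_squared:
  fixes f :: "real^'n \<Rightarrow> real"
  assumes G: "open G" and f: "C2_on G f"
  shows "has_C1_gradient G (\<lambda>x. (norm (gradient f x))\<^sup>2) (\<lambda>x. 2 *\<^sub>R (hessian f x *v gradient f x))"
proof -
  have grad: "has_C1_gradient G (partial_deriv j f) (gradient (partial_deriv j f))" for j
    using f G by (intro C1_on_imp_has_C1_gradient) (auto simp: C2_on_def)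
  have w_eq: "2 *\<^sub>R (hessian f x *v gradient f x) =
      (\<Sum>j\<in>UNIV. (2 * partial_deriv j f x) *\<^sub>R gradient (partial_deriv j f) x)" for x
    by (simp add: vec_eq_iff matrix_vector_mult_def hessian_def gradient_def sum_component
        sum_distrib_left mult_ac)
  show ?thesis
    unfolding has_C1_gradient_def
  proof (intro conjI ballI)
    fix x assume x: "x \<in> G"
    have "((\<lambda>x. \<Sum>j\<in>UNIV. (partial_deriv j f x)\<^sup>2) has_derivative
        (\<lambda>v. \<Sum>j\<in>UNIV. 2 * partial_deriv j f x * (gradient (partial_deriv j f) x \<bullet> v))) (at x)"
    proof (rule has_derivative_sum)
      fix j
      have "(partial_deriv j f has_derivative (\<lambda>v. gradient (partial_deriv j f) x \<bullet> v)) (at x)"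
        using grad[of j] x by (simp add: has_C1_gradient_def)
      from has_derivative_power[OF this, of 2]
      show "((\<lambda>x. (partial_deriv j f x)\<^sup>2) has_derivative
          (\<lambda>v. 2 * partial_deriv j f x * (gradient (partial_deriv j f) x \<bullet> v))) (at x)"
        by (simp add: mult_ac)
    qed
    then show "((\<lambda>x. (norm (gradient f x))\<^sup>2) has_derivative
        (\<lambda>v. (2 *\<^sub>R (hessian f x *v gradient f x)) \<bullet> v)) (at x)"
      unfolding norm_gradient w_eq by (simp add: inner_sum_left)
  next
    show "continuous_on G (\<lambda>x. 2 *\<^sub>R (hessian f x *v gradient f x))"
      unfolding w_eq
      using grad has_C1_gradient_imp_continuous_on[OF grad]
      by (intro continuous_intros) (auto simp: has_C1_gradient_def)
  qed
qed

theorem theorem1p5: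
  fixes G :: "(real^'n) set" and M :: "(real^'n) measure"
    and f :: "real^'n \<Rightarrow> real" and \<sigma> b b\<^sub>0 :: real
  assumes "open G"
    and "prob_space M"
    and "sets M = sets (restrict_space borel G)"
    and "\<sigma>\<^sup>2 > 0"
    and "log_sobolev G M (\<sigma>\<^sup>2)"
    and "C2_on G f"
    and "integrable M f"
    and "\<And>i. integrable M (partial_deriv i f)"
    and "(\<integral>x. f x \<partial>M) = 0"
    and "b\<^sub>0 \<ge> 0"
    and "(\<Sum>i\<in>UNIV. (\<integral>x. partial_deriv i f x \<partial>M)\<^sup>2) \<le> \<sigma>\<^sup>2 * b\<^sub>0\<^sup>2"
    and "\<And>x. x \<in> G \<Longrightarrow> op_norm (hessian f x) \<le> 1"
    and "b \<ge> 0"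
    and "(\<integral>\<^sup>+ x. ennreal ((hs_norm (hessian f x))\<^sup>2) \<partial>M) \<le> ennreal (b\<^sup>2)"
  shows "(\<integral>\<^sup>+ x. ennreal (exp (1 / (\<sigma>\<^sup>2 * (4 + 4 * b\<^sup>2 + 5 * b\<^sub>0)) * \<bar>f x\<bar>)) \<partial>M) \<le> 2"
proof -
  define c where "c = \<sigma>\<^sup>2"
  have c: "c > 0" using assms(4) by (simp add: c_def)
  interpret prob_space M by fact
  interpret log_sobolev_space M G c
    using assms(1,3-5) by unfold_locales (auto simp: c_def)
  have f: "has_C1_gradient G f (gradient f)"
    using assms(1,6) by (intro C1_on_imp_has_C1_gradient) (auto simp: C2_on_def)
  have pf: "has_C1_gradient G (partial_deriv j f) (gradient (partial_deriv j f))" for j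
    using assms(1,6) by (intro C1_on_imp_has_C1_gradient) (auto simp: C2_on_def)
  note meas = has_C1_gradient_measurable[OF f] has_C1_gradient_measurable[OF pf]
  have hess_le: "norm (hessian f x *v v) \<le> norm v" if "x \<in> G" for x v
    using norm_matrix_vector_le_op_norm[of "hessian f x" v]
      mult_right_mono[OF assms(12)[OF that], of "norm v"] by simp
  have int_grad: "integrable M (\<lambda>x. (norm (gradient (partial_deriv j f) x))\<^sup>2)" for j
  proof (rule integrable_const_bound[where B=1])
    show "AE x in M. norm ((norm (gradient (partial_deriv j f) x))\<^sup>2) \<le> 1"
    proof (rule AE_I2)
      fix x assume "x \<in> space M"
      then have "norm (gradient (partial_deriv j f) x) \<le> 1"
        using hess_le[of x "axis j 1"] by (simp add: gradient_partial_deriv_eq)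
      then show "norm ((norm (gradient (partial_deriv j f) x))\<^sup>2) \<le> 1"
        by (simp add: power_le_one)
    qed
  qed (use meas in measurable)
  have hs: "(\<Sum>j\<in>UNIV. expectation (\<lambda>x. (norm (gradient (partial_deriv j f) x))\<^sup>2)) \<le> b\<^sup>2"
  proof -
    have "integrable M (\<lambda>x. (hs_norm (hessian f x))\<^sup>2)"
      unfolding hs_norm_hessian using int_grad by simp
    then have "expectation (\<lambda>x. (hs_norm (hessian f x))\<^sup>2) \<le> b\<^sup>2"
      using assms(14) by (simp add: nn_integral_eq_integral)
    then show ?thesis
      unfolding hs_norm_hessian using int_grad by simp
  qed
  define F where "F x = (norm (gradient f x))\<^sup>2" for x
  note poinc = poincare[OF pf assms(8) int_grad]
  have F_int: "integrable M F"
    unfolding F_def norm_gradient using poinc(1) by simp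
  have F_mean: "expectation F \<le> c * (b\<^sub>0\<^sup>2 + 2 * b\<^sup>2)"
  proof -
    have "expectation F = (\<Sum>j\<in>UNIV. expectation (\<lambda>x. (partial_deriv j f x)\<^sup>2))"
      unfolding F_def norm_gradient using poinc(1) by simp
    also have "\<dots> \<le> (\<Sum>j\<in>UNIV. (expectation (partial_deriv j f))\<^sup>2 +
        2 * c * expectation (\<lambda>x. (norm (gradient (partial_deriv j f) x))\<^sup>2))"
      by (intro sum_mono poinc(2))
    also have "\<dots> = (\<Sum>j\<in>UNIV. (expectation (partial_deriv j f))\<^sup>2) +
        2 * c * (\<Sum>j\<in>UNIV. expectation (\<lambda>x. (norm (gradient (partial_deriv j f) x))\<^sup>2))"
      by (simp add: sum.distrib sum_distrib_left)
    also have "\<dots> \<le> c * b\<^sub>0\<^sup>2 + 2 * c * b\<^sup>2"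
      using assms(11) hs c by (intro add_mono mult_left_mono) (auto simp: c_def)
    finally show ?thesis by (simp add: algebra_simps)
  qed

  define K where "K = 4 + 4 * b\<^sup>2 + 5 * b\<^sub>0"
  define l where "l = 1 / (c * K)"
  define T where "T = c * (2 * l)\<^sup>2"
  have K: "K \<ge> 4" using assms(10) by (simp add: K_def)
  (* The first estimate makes the exponent of exp_moment_self_bounding at most 1/4, since
     T / (1 - 2 c T) = 4 / (c (K^2 - 8)); the second one gives 2 c T = 8 / K^2 < 1. *)
  have K2: "16 * (b\<^sub>0\<^sup>2 + 2 * b\<^sup>2) \<le> K\<^sup>2 - 8" "16 \<le> K\<^sup>2"
  proof -
    have "K\<^sup>2 = 16 + 32 * b\<^sup>2 + 25 * b\<^sub>0\<^sup>2 + (16 * (b\<^sup>2)\<^sup>2 + 40 * b\<^sub>0 + 40 * (b\<^sup>2 * b\<^sub>0))"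
      by (simp add: K_def power2_eq_square algebra_simps)
    moreover have "0 \<le> 16 * (b\<^sup>2)\<^sup>2 + 40 * b\<^sub>0 + 40 * (b\<^sup>2 * b\<^sub>0)"
      using assms(10) by simp
    moreover have "0 \<le> b\<^sub>0\<^sup>2" "0 \<le> b\<^sup>2" by simp_all
    ultimately show "16 * (b\<^sub>0\<^sup>2 + 2 * b\<^sup>2) \<le> K\<^sup>2 - 8" and "16 \<le> K\<^sup>2"
      unfolding distrib_left by linarith+
  qed
  have l: "l > 0" using c K by (simp add: l_def)
  have T_eq: "T = 4 / (c * K\<^sup>2)"
    using c K by (simp add: T_def l_def power2_eq_square)
  have T: "0 < T" "2 * c * T < 1"
    using c K K2 by (auto simp: T_eq)
  have exponent: "T / (1 - 2 * c * T) * expectation F \<le> ln 2"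
  proof -
    have "T / (1 - 2 * c * T) = 4 / (c * (K\<^sup>2 - 8))"
      using c K K2 by (simp add: T_eq field_simps)
    then have "T / (1 - 2 * c * T) * expectation F \<le> 4 / (c * (K\<^sup>2 - 8)) * (c * (b\<^sub>0\<^sup>2 + 2 * b\<^sup>2))"
      using F_mean c K2 by (simp only:) (intro mult_left_mono, auto)
    also have "\<dots> = 4 * (b\<^sub>0\<^sup>2 + 2 * b\<^sup>2) / (K\<^sup>2 - 8)"
      using c by simp
    also have "\<dots> \<le> 1 / 4"
      using K2 by (simp add: field_simps)
    also have "\<dots> \<le> ln 2"
      using ln2_ge_two_thirds by simp
    finally show ?thesis .
  qed
  have "(\<integral>\<^sup>+ x. ennreal (exp (T * F x)) \<partial>M) \<le> ennreal (exp (T / (1 - 2 * c * T) * expectation F))"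
  proof (rule exp_moment_self_bounding[OF _ _ _ F_int T])
    show "has_C1_gradient G F (\<lambda>x. 2 *\<^sub>R (hessian f x *v gradient f x))"
      unfolding F_def by (rule has_C1_gradient_norm_gradient_squared[OF assms(1,6)])
    show "(norm (2 *\<^sub>R (hessian f x *v gradient f x)))\<^sup>2 \<le> 4 * F x" if "x \<in> G" for x
      using power_mono[OF hess_le[OF that, of "gradient f x"], of 2]
      by (simp add: F_def power_mult_distrib)
  qed (simp add: F_def)
  also have "\<dots> \<le> ennreal (exp (ln 2))"
    using exponent by (intro ennreal_leI) (simp only: exp_le_cancel_iff)
  finally have "(\<integral>\<^sup>+ x. ennreal (exp (T * F x)) \<partial>M) \<le> ennreal 2"
    by simp
  from integrable_exp_of_nn_integral_le[OF _ this] F_int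
  have exp_F: "integrable M (\<lambda>x. exp (T * F x))" "expectation (\<lambda>x. exp (T * F x)) \<le> 2"
    by auto
  have one_sided: "integrable M (\<lambda>x. exp (2 * l * g x))" "expectation (\<lambda>x. exp (2 * l * g x)) \<le> 2"
    if g: "has_C1_gradient G g w" "integrable M g" "expectation g = 0"
      and w: "\<And>x. (norm (w x))\<^sup>2 = F x" for g w
  proof -
    have "(\<integral>\<^sup>+ x. ennreal (exp (2 * l * g x)) \<partial>M) \<le> ennreal (expectation (\<lambda>x. exp (T * F x)))"
      using exp_moment_gradient[OF g, of "2 * l"] l exp_F(1) by (simp only: w flip: T_def)
    also have "\<dots> \<le> ennreal 2"
      by (rule ennreal_leI[OF exp_F(2)])
    finally have "(\<integral>\<^sup>+ x. ennreal (exp (2 * l * g x)) \<partial>M) \<le> ennreal 2" .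
    from integrable_exp_of_nn_integral_le[OF _ this] g(2)
    show "integrable M (\<lambda>x. exp (2 * l * g x))" "expectation (\<lambda>x. exp (2 * l * g x)) \<le> 2"
      by auto
  qed
  have minus_f: "has_C1_gradient G (\<lambda>x. - f x) (\<lambda>x. - gradient f x)"
    using has_C1_gradient_compose[OF f, of uminus "\<lambda>_. -1"] by (simp add: DERIV_minus)
  note plus = one_sided[OF f assms(7,9)]
  note minus = one_sided[OF minus_f]
  (* integrable majorant of exp (l |f|), from z <= 1 + z^2 / 4 *)
  define E where "E x = 1 + (exp (2 * l * f x) + exp (2 * l * (- f x))) / 4" for x
  have E: "integrable M E" "expectation E \<le> 2"
    using plus minus assms(7,9) by (simp_all add: E_def[abs_def] F_def)
  have "exp (l * \<bar>f x\<bar>) \<le> E x" for x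
  proof -
    define z where "z = exp (l * \<bar>f x\<bar>)"
    have "0 \<le> (z / 2 - 1)\<^sup>2" by simp
    then have "z \<le> 1 + z\<^sup>2 / 4"
      by (simp add: power2_eq_square field_simps)
    also have "z\<^sup>2 = exp (2 * l * \<bar>f x\<bar>)"
      by (simp add: z_def power2_eq_square flip: exp_add)
    also have "exp (2 * l * \<bar>f x\<bar>) \<le> exp (2 * l * f x) + exp (2 * l * (- f x))"
      by (cases "f x \<ge> 0") auto
    finally show ?thesis
      by (simp add: E_def z_def divide_right_mono)
  qed
  then have "(\<integral>\<^sup>+ x. ennreal (exp (l * \<bar>f x\<bar>)) \<partial>M) \<le> (\<integral>\<^sup>+ x. ennreal (E x) \<partial>M)"
    by (intro nn_integral_mono ennreal_leI)
  also have "\<dots> = ennreal (expectation E)"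
    by (rule nn_integral_eq_integral[OF E(1)]) (simp add: E_def)
  also have "\<dots> \<le> ennreal 2"
    by (rule ennreal_leI[OF E(2)])
  finally show ?thesis
    by (simp add: l_def K_def c_def)
qed

end
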